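(* For any $n>0$ and $S\subseteq[2n-1]$ with $|S|=k$, the value $\beta_n(S)$ of the flag $h$-vector of $J(\mathbf{2}\times\mathbf{n})$ equals the number of semistandard Young tableaux $T$ of shape $\langle 2^k\rangle$ with all entries less than $n$ whose set of row sums $\{\gamma_1(T),\dots,\gamma_k(T)\}$ equals $S$.
   Context: $\langle 2^k\rangle$ is the partition $(2,2,\dots,2)$ with $k$ parts. A semistandard Young tableau of shape $\lambda$ is an array $T=(T_{ij})$ of positive integers, $1\le i\le\ell(\lambda)$, $1\le j\le\lambda_i$, weakly increasing along rows and strictly increasing down columns. The row sums are $\gamma_i(T)=\sum_j T_{ij}$ and the paper writes $\mathrm{row}(T)=(\gamma_1(T),\gamma_2(T),\dots)$. $\mathbf{2}\times\mathbf{n}$ is the product of chains $\{1<2\}\times\{1<\dots<n\}$; $J(\mathbf{2}\times\mathbf{n})$ is its lattice of order ideals, graded of rank $2n$ by cardinality. For a finite graded poset $P$ with $\hat0,\hat1$, rank function $\rho$, $\rho(\hat1)=N$, the flag $f$-vector is $\alpha_P(S)=|\{c\text{ a chain of }P:\rho(c)=S\}|$ for $S\subseteq[N-1]$, and the flag $h$-vector is $\beta_P(S)=\sum_{T\subseteq S}(-1)^{|S-T|}\alpha_P(T)$; $\beta_n=\beta_{J(\mathbf{2}\times\mathbf{n})}$. *)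

theory Defs
  imports Main "HOL-Library.Product_Order"
begin

text \<open>
  A finite poset is a finite subset P of a type of class \<open>order\<close>, with the induced order.
  The product order on pairs is the componentwise one of \<open>Product_Order\<close>; on sets the
  order is inclusion.
\<close>

definition order_ideals :: "'a::order set \<Rightarrow> 'a set set" where
  "order_ideals P = {I. I \<subseteq> P \<and> (\<forall>x\<in>I. \<forall>y\<in>P. y \<le> x \<longrightarrow> y \<in> I)}"

definition two_times :: "nat \<Rightarrow> (nat \<times> nat) set" where
  "two_times n = {1..2} \<times> {1..n}"

definition poset_chains :: "'a::order set \<Rightarrow> 'a set set" where
  "poset_chains P = {c. c \<subseteq> P \<and> Complete_Partial_Order.chain (\<le>) c}"

text \<open>
  The rank of x is the length (number of elements minus one) of a longest chain below x; for a
  graded P it is the usual rank function. The lemma \<open>poset_rank_order_ideals\<close> below shows that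
  on order ideals it is the cardinality.
\<close>

definition poset_rank :: "'a::order set \<Rightarrow> 'a \<Rightarrow> nat" where
  "poset_rank P x = Max ((\<lambda>c. card c - 1) ` poset_chains {y\<in>P. y \<le> x})"

definition flag_f :: "'a::order set \<Rightarrow> nat set \<Rightarrow> nat" where
  "flag_f P S = card {c \<in> poset_chains P. poset_rank P ` c = S}"

definition flag_h :: "'a::order set \<Rightarrow> nat set \<Rightarrow> int" where
  "flag_h P S = (\<Sum>T\<in>Pow S. (- 1) ^ card (S - T) * int (flag_f P T))"

text \<open>
  A tableau is the list of its rows, top to bottom, and a shape is the list of row lengths
  (a weakly decreasing list of positive numbers). Indices start at 0, entries are positive.
\<close>

definition semistandard_tableaux :: "nat list \<Rightarrow> nat list list set" where
  "semistandard_tableaux shape =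
    {T. map length T = shape \<and>
        (\<forall>r\<in>set T. \<forall>x\<in>set r. 0 < x) \<and>
        (\<forall>r\<in>set T. sorted r) \<and>
        (\<forall>i i' j. i < i' \<and> i' < length T \<and> j < length (T ! i') \<longrightarrow> T ! i ! j < T ! i' ! j)}"

definition row_sums :: "nat list list \<Rightarrow> nat list" where
  "row_sums T = map sum_list T"

lemma order_ideals_maximal_chain:
  fixes P :: "'a::order set"
  assumes "finite P" "I \<in> order_ideals P"
  shows "\<exists>c \<in> poset_chains {y \<in> order_ideals P. y \<le> I}. finite c \<and> card c = Suc (card I)"
  using assms(2)
proof (induction "card I" arbitrary: I)
  case 0
  then have "I = {}"
    using assms(1) finite_subset[of I P] by (auto simp: order_ideals_def)
  with 0 show ?case
    by (intro bexI[of _ "{{}}"]) (auto simp: poset_chains_def chain_def)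
next
  case (Suc n)
  have fin: "finite I"
    using Suc.prems assms(1) finite_subset[of I P] by (auto simp: order_ideals_def)
  moreover have "I \<noteq> {}"
    using Suc.hyps(2) by auto
  ultimately obtain m where m: "m \<in> I" "\<And>x. x \<in> I \<Longrightarrow> m \<le> x \<Longrightarrow> m = x"
    using finite_has_maximal[of I] by blast
  have "I - {m} \<in> order_ideals P"
    using Suc.prems m by (auto simp: order_ideals_def)
  moreover have card_m: "n = card (I - {m})"
    using Suc.hyps(2) fin m(1) by simp
  ultimately obtain c where c: "c \<in> poset_chains {y \<in> order_ideals P. y \<le> I - {m}}"
      "finite c" "card c = Suc (card (I - {m}))"
    using Suc.hyps(1) by blast
  have "I \<notin> c"
    using c(1) m(1) by (auto simp: poset_chains_def)
  then have "card (insert I c) = Suc (card I)"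
    using c card_m Suc.hyps(2) by simp
  moreover have "insert I c \<in> poset_chains {y \<in> order_ideals P. y \<le> I}"
    using c(1) Suc.prems unfolding poset_chains_def chain_def by blast
  ultimately show ?case
    using c(2) by blast
qed

lemma poset_rank_order_ideals:
  fixes P :: "'a::order set"
  assumes "finite P" "I \<in> order_ideals P"
  shows "poset_rank (order_ideals P) I = card I"
proof -
  let ?C = "poset_chains {y \<in> order_ideals P. y \<le> I}"
  have fin: "finite I"
    using assms finite_subset[of I P] by (auto simp: order_ideals_def)
  have "card c - 1 \<le> card I" if c: "c \<in> ?C" for c
  proof -
    have sub: "A \<subseteq> I" if "A \<in> c" for A
      using c that by (auto simp: poset_chains_def)
    have "inj_on card c"
    proof (rule inj_onI)
      fix A B assume AB: "A \<in> c" "B \<in> c" "card A = card B"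
      then have "finite A" "finite B"
        using sub fin finite_subset by blast+
      moreover have "A \<subseteq> B \<or> B \<subseteq> A"
        using c AB by (auto simp: poset_chains_def chain_def)
      ultimately show "A = B"
        using AB(3) card_subset_eq by metis
    qed
    moreover have "card ` c \<subseteq> {0..card I}"
      using sub card_mono[OF fin] by auto
    ultimately have "card c \<le> card {0..card I}"
      by (intro card_inj_on_le) auto
    then show ?thesis by simp
  qed
  moreover have "finite ?C"
    by (rule finite_subset[of _ "Pow (Pow I)"]) (use fin in \<open>auto simp: poset_chains_def\<close>)
  moreover have "card I \<in> (\<lambda>c. card c - 1) ` ?C"
    using order_ideals_maximal_chain[OF assms] by force
  ultimately show ?thesis
    unfolding poset_rank_def by (intro Max_eqI) auto
qed

end

theory Submission
  imports Defs "HOL-Library.FuncSet"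
begin

text \<open>
  An order ideal of the product of chains is given by its numbers of elements \<open>a \<ge> b\<close> in the
  two chains, so a chain of ideals is a weakly increasing sequence of lattice points. Joining
  consecutive points by the path that first increases \<open>a\<close> and then \<open>b\<close> gives a Dyck path whose valleys
  are among the points, and a Dyck path is determined by its valleys. The valleys form a sequence that
  increases strictly in both coordinates; read as rows \<open>(b, a)\<close>, it is a semistandard tableau with
  two columns. Hence the flag f-vector at \<open>S\<close> is the sum over \<open>T \<subseteq> S\<close> of the number of
  tableaux with row sums \<open>T\<close>, and Moebius inversion gives the theorem.
\<close>

section \<open>Moebius inversion on the Boolean lattice\<close>

text \<open>Pair \<open>T\<close> with \<open>insert x T\<close> for a new element \<open>x\<close>:
  their signs are opposite, so every \<open>g U\<close> with \<open>x\<close> not in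
  \<open>U\<close> cancels. What remains is the same sum over \<open>S\<close> for the function
  sending \<open>U\<close> to \<open>g (insert x U)\<close>, which is why \<open>g\<close> is
  arbitrary in the induction.\<close>

lemma alternating_sum_Pow:
  fixes g :: "'a set \<Rightarrow> int"
  assumes "finite S"
  shows "(\<Sum>T\<in>Pow S. (- 1) ^ card (S - T) * (\<Sum>U\<in>Pow T. g U)) = g S"
  using assms
proof (induction S arbitrary: g rule: finite_induct)
  case empty
  then show ?case by simp
next
  case (insert x S)
  have split: "(\<Sum>U\<in>Pow (insert x T). h U) = (\<Sum>U\<in>Pow T. h U) + (\<Sum>U\<in>Pow T. h (insert x U))"
    if "T \<subseteq> S" for T and h :: "'a set \<Rightarrow> int"
  proof -
    have fin: "finite T" and x: "x \<notin> T"
      using that insert.hyps finite_subset by auto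
    have "inj_on (insert x) (Pow T)"
      using x by (auto simp: inj_on_def)
    moreover have "Pow T \<inter> insert x ` Pow T = {}"
      using x by auto
    ultimately show ?thesis
      using fin by (simp add: Pow_insert sum.union_disjoint sum.reindex)
  qed
  have "(\<Sum>T\<in>Pow (insert x S). (- 1) ^ card (insert x S - T) * (\<Sum>U\<in>Pow T. g U)) =
      (\<Sum>T\<in>Pow S. (- 1) ^ card (insert x S - T) * (\<Sum>U\<in>Pow T. g U)
        + (- 1) ^ card (insert x S - insert x T) * (\<Sum>U\<in>Pow (insert x T). g U))"
    using split[OF subset_refl] by (simp add: sum.distrib)
  also have "\<dots> = (\<Sum>T\<in>Pow S. (- 1) ^ card (S - T) * (\<Sum>U\<in>Pow T. g (insert x U)))"
  proof (rule sum.cong[OF refl])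
    fix T assume "T \<in> Pow S"
    then have T: "T \<subseteq> S" by simp
    then have "insert x S - T = insert x (S - T)" "insert x S - insert x T = S - T"
      using insert.hyps by auto
    then show "(- 1) ^ card (insert x S - T) * (\<Sum>U\<in>Pow T. g U)
        + (- 1) ^ card (insert x S - insert x T) * (\<Sum>U\<in>Pow (insert x T). g U)
        = (- 1) ^ card (S - T) * (\<Sum>U\<in>Pow T. g (insert x U))"
      using insert.hyps by (simp add: split[OF T] algebra_simps)
  qed
  also have "\<dots> = g (insert x S)"
    by (rule insert.IH)
  finally show ?case .
qed

section \<open>Counting weak paths by their valleys\<close>

text \<open>
  A function \<open>f\<close> on the rank set encodes the lattice points \<open>(s - f s, f s)\<close>. The bounds on
  \<open>strict_paths\<close> are those for the valleys of a path ending in \<open>(a, b)\<close>: a valley is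
  left by a step in the first coordinate, hence \<open>s - f s < a\<close> but only \<open>f s \<le> b\<close>.
\<close>

definition weak_paths :: "nat set \<Rightarrow> nat \<Rightarrow> nat \<Rightarrow> (nat \<Rightarrow> nat) set" where
  "weak_paths S a b = {f \<in> extensional S.
    (\<forall>s\<in>S. 2 * f s \<le> s \<and> f s \<le> b \<and> s - f s \<le> a) \<and>
    (\<forall>s\<in>S. \<forall>t\<in>S. s < t \<longrightarrow> f s \<le> f t \<and> s - f s \<le> t - f t)}"

definition strict_paths :: "nat set \<Rightarrow> nat \<Rightarrow> nat \<Rightarrow> (nat \<Rightarrow> nat) set" where
  "strict_paths S a b = {f \<in> extensional S.
    (\<forall>s\<in>S. 0 < f s \<and> 2 * f s \<le> s \<and> f s \<le> b \<and> s - f s < a) \<and>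
    (\<forall>s\<in>S. \<forall>t\<in>S. s < t \<longrightarrow> f s < f t \<and> s - f s < t - f t)}"

lemma finite_weak_paths:
  assumes "finite S"
  shows "finite (weak_paths S a b)"
proof (rule finite_subset)
  show "weak_paths S a b \<subseteq> S \<rightarrow>\<^sub>E {..b}"
  proof
    fix f assume "f \<in> weak_paths S a b"
    then have "f \<in> extensional S" "\<forall>s\<in>S. f s \<le> b"
      by (simp_all add: weak_paths_def)
    then show "f \<in> S \<rightarrow>\<^sub>E {..b}"
      by (simp add: PiE_iff)
  qed
  show "finite (S \<rightarrow>\<^sub>E {..b})"
    using assms by (simp add: finite_PiE)
qed

lemma finite_strict_paths:
  assumes "finite S"
  shows "finite (strict_paths S a b)"
proof (rule finite_subset)
  show "strict_paths S a b \<subseteq> S \<rightarrow>\<^sub>E {..b}"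
  proof
    fix f assume "f \<in> strict_paths S a b"
    then have "f \<in> extensional S" "\<forall>s\<in>S. f s \<le> b"
      by (simp_all add: strict_paths_def)
    then show "f \<in> S \<rightarrow>\<^sub>E {..b}"
      by (simp add: PiE_iff)
  qed
  show "finite (S \<rightarrow>\<^sub>E {..b})"
    using assms by (simp add: finite_PiE)
qed

text \<open>Counts \<open>F\<close> by the value \<open>q\<close> at a new point \<open>s\<close>;
  both recursions in the largest rank rest on it. Resetting \<open>s\<close> to
  \<open>undefined\<close> inverts the update because members of \<open>G q\<close> are extensional
  on \<open>S\<close>.\<close>

lemma card_extend_extensional:
  assumes "s \<notin> S" "finite Q" "\<And>q. q \<in> Q \<Longrightarrow> finite (G q)"
    and "\<And>q. q \<in> Q \<Longrightarrow> G q \<subseteq> extensional S"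
    and "\<And>q g. q \<in> Q \<Longrightarrow> g \<in> G q \<Longrightarrow> g(s := q) \<in> F"
    and "\<And>f. f \<in> F \<Longrightarrow> f s \<in> Q \<and> f(s := undefined) \<in> G (f s)"
  shows "card F = (\<Sum>q\<in>Q. card (G q))"
proof -
  have "bij_betw (\<lambda>(q, g). g(s := q)) (SIGMA q:Q. G q) F"
  proof (rule bij_betw_byWitness[where f' = "\<lambda>f. (f s, f(s := undefined))"])
    have "g(s := undefined) = g" if "q \<in> Q" "g \<in> G q" for q g
      using assms(1) assms(4)[OF that(1)] that(2) by (auto simp: extensional_def fun_eq_iff)
    then show "\<forall>x\<in>SIGMA q:Q. G q.
        (\<lambda>f. (f s, f(s := undefined))) ((\<lambda>(q, g). g(s := q)) x) = x"
      by auto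
  qed (use assms(5,6) in auto)
  then have "card F = card (SIGMA q:Q. G q)"
    by (simp add: bij_betw_same_card)
  then show ?thesis
    using assms(2,3) by (simp add: card_SigmaI)
qed

text \<open>The largest rank carries the last point \<open>(s - q, q)\<close>. By monotonicity it
  bounds all earlier points, so it takes over the role of the endpoint
  \<open>(a, b)\<close>.\<close>

lemma card_weak_paths_insert:
  assumes "finite S" "\<And>t. t \<in> S \<Longrightarrow> t < s"
  shows "card (weak_paths (insert s S) a b) =
    (\<Sum>q | 2 * q \<le> s \<and> q \<le> b \<and> s - q \<le> a. card (weak_paths S (s - q) q))"
proof (rule card_extend_extensional)
  show "s \<notin> S" using assms(2) by auto
  show "finite {q. 2 * q \<le> s \<and> q \<le> b \<and> s - q \<le> a}"
    by (rule finite_subset[of _ "{..b}"]) auto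
  show "finite (weak_paths S (s - q) q)" for q
    using assms(1) by (rule finite_weak_paths)
  show "weak_paths S (s - q) q \<subseteq> extensional S" for q
    by (auto simp: weak_paths_def)
next
  fix q g assume "q \<in> {q. 2 * q \<le> s \<and> q \<le> b \<and> s - q \<le> a}" "g \<in> weak_paths S (s - q) q"
  then show "g(s := q) \<in> weak_paths (insert s S) a b"
    using assms(2) by (fastforce simp: weak_paths_def extensional_def)
next
  fix f assume "f \<in> weak_paths (insert s S) a b"
  then show "f s \<in> {q. 2 * q \<le> s \<and> q \<le> b \<and> s - q \<le> a} \<and>
      f(s := undefined) \<in> weak_paths S (s - f s) (f s)"
    using assms(2) by (fastforce simp: weak_paths_def extensional_def)
qed

definition strict_exts :: "nat set \<Rightarrow> nat \<Rightarrow> nat \<Rightarrow> nat \<Rightarrow> (nat \<Rightarrow> nat) \<Rightarrow> nat set" where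
  "strict_exts T s a b g = {q. 0 < q \<and> 2 * q \<le> s \<and> q \<le> b \<and> s - q < a \<and>
    (\<forall>t\<in>T. g t < q \<and> t - g t < s - q)}"

text \<open>Here the count is grouped by the earlier valleys \<open>g\<close> and not by the last
  value, since weak and strict extensions are to be compared for each fixed \<open>g\<close>. The
  regrouping is a double count of the pairs \<open>(q, g)\<close>.\<close>

lemma card_strict_paths_insert:
  assumes "finite T" "\<And>t. t \<in> T \<Longrightarrow> t < s"
  shows "card (strict_paths (insert s T) a b) =
    (\<Sum>g\<in>strict_paths T a b. card (strict_exts T s a b g))"
proof -
  let ?G = "\<lambda>q. {g \<in> strict_paths T a b. q \<in> strict_exts T s a b g}"
  have "card (strict_paths (insert s T) a b) = (\<Sum>q\<le>b. card (?G q))"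
  proof (rule card_extend_extensional)
    show "s \<notin> T" using assms(2) by auto
    show "finite (?G q)" for q
      using finite_strict_paths[OF assms(1)] by simp
    show "?G q \<subseteq> extensional T" for q
      by (auto simp: strict_paths_def)
  next
    fix q g assume "g \<in> ?G q"
    then show "g(s := q) \<in> strict_paths (insert s T) a b"
      using assms(2) by (fastforce simp: strict_paths_def strict_exts_def extensional_def)
  next
    fix f assume "f \<in> strict_paths (insert s T) a b"
    then show "f s \<in> {..b} \<and> f(s := undefined) \<in> ?G (f s)"
      using assms(2) by (fastforce simp: strict_paths_def strict_exts_def extensional_def)
  qed simp
  also have "\<dots> = (\<Sum>g\<in>strict_paths T a b. card {q \<in> {..b}. q \<in> strict_exts T s a b g})"
    by (rule sum_multicount_gen) (use finite_strict_paths[OF assms(1)] in auto)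
  also have "\<dots> = (\<Sum>g\<in>strict_paths T a b. card (strict_exts T s a b g))"
    by (intro sum.cong refl arg_cong[where f = card]) (auto simp: strict_exts_def)
  finally show ?thesis .
qed

text \<open>
  For fixed valleys at ranks in \<open>T\<close>, the points of rank \<open>s\<close> that the path can reach
  are the possible further valleys and one more: the point where the path to \<open>(a, b)\<close> with no
  further valley crosses rank \<open>s\<close>, whose second coordinate is \<open>max m (s - a)\<close>.
\<close>

lemma sum_card_strict_paths:
  assumes "finite T" "\<And>t. t \<in> T \<Longrightarrow> t < s" "s \<le> a + b" "b \<le> a"
  shows "(\<Sum>q | 2 * q \<le> s \<and> q \<le> b \<and> s - q \<le> a. card (strict_paths T (s - q) q)) =
    card (strict_paths T a b) + card (strict_paths (insert s T) a b)"
proof -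
  let ?Q = "{q. 2 * q \<le> s \<and> q \<le> b \<and> s - q \<le> a}"
  let ?R = "\<lambda>g q. \<forall>t\<in>T. g t \<le> q \<and> t - g t < s - q"
  have finQ: "finite ?Q"
    by (rule finite_subset[of _ "{..b}"]) auto
  \<comment> \<open>As \<open>q \<le> b\<close> and \<open>s - q \<le> a\<close>, the bounds set by
    \<open>(s - q, q)\<close> imply those set by \<open>(a, b)\<close>; \<open>?R\<close> is what
    they demand in addition.\<close>
  have "strict_paths T (s - q) q = {g \<in> strict_paths T a b. ?R g q}" if "q \<in> ?Q" for q
    using that by (fastforce simp: strict_paths_def)
  then have "(\<Sum>q\<in>?Q. card (strict_paths T (s - q) q)) =
      (\<Sum>q\<in>?Q. card {g \<in> strict_paths T a b. ?R g q})"
    by (intro sum.cong) auto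
  also have "\<dots> = (\<Sum>g\<in>strict_paths T a b. card {q \<in> ?Q. ?R g q})"
    by (rule sum_multicount_gen) (use finite_strict_paths[OF assms(1)] finQ in auto)
  also have "\<dots> = (\<Sum>g\<in>strict_paths T a b. Suc (card (strict_exts T s a b g)))"
  proof (rule sum.cong[OF refl])
    fix g assume g: "g \<in> strict_paths T a b"
    \<comment> \<open>Both coordinates increase along \<open>T\<close>, so only the valley at
      \<open>Max T\<close> constrains \<open>q\<close>. The default 0 stands for the start of the
      path and also encodes the condition \<open>0 < q\<close>.\<close>
    define m where "m = (if T = {} then 0 else g (Max T))"
    have m_ge: "g t \<le> m" if "t \<in> T" for t
    proof -
      have "Max T \<in> T" "t \<le> Max T" using that assms(1) Max_in by auto
      then show ?thesis
        using g that by (cases "t = Max T") (fastforce simp: strict_paths_def m_def)+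
    qed
    have diff_le: "t - g t \<le> Max T - m" if "t \<in> T" for t
    proof -
      have "Max T \<in> T" "t \<le> Max T" using that assms(1) Max_in by auto
      then show ?thesis
        using g that by (cases "t = Max T") (fastforce simp: strict_paths_def m_def)+
    qed
    have Max: "m = g (Max T)" "Max T \<in> T" if "T \<noteq> {}"
      using assms(1) that Max_in by (auto simp: m_def)
    have R: "?R g q \<longleftrightarrow> (T = {} \<or> m \<le> q \<and> Max T - m < s - q)" for q
    proof (cases "T = {}")
      case False
      then show ?thesis
        using Max[OF False] m_ge diff_le by (auto intro: order_trans le_less_trans)
    qed simp
    have R': "(\<forall>t\<in>T. g t < q \<and> t - g t < s - q) \<longleftrightarrow> (T = {} \<or> m < q \<and> Max T - m < s - q)" for q
    proof (cases "T = {}")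
      case False
      then show ?thesis
        using Max[OF False] m_ge diff_le by (auto intro: le_less_trans)
    qed simp
    have m: "T = {} \<and> m = 0 \<or> T \<noteq> {} \<and> Max T < s \<and> 0 < m \<and> 2 * m \<le> Max T \<and> m \<le> b \<and> Max T - m < a"
    proof (cases "T = {}")
      case False
      then show ?thesis
        using Max[OF False] g assms(2) by (auto simp: strict_paths_def)
    qed (simp add: m_def)
    \<comment> \<open>Every admissible \<open>q\<close> is at least \<open>max m (s - a)\<close>,
      and those above it are the strict extensions. That the minimum itself is admissible uses
      \<open>s \<le> a + b\<close> for \<open>s - a \<le> b\<close>, and with
      \<open>b \<le> a\<close> also for \<open>2 * (s - a) \<le> s\<close>.\<close>
    have "{q \<in> ?Q. ?R g q} = insert (max m (s - a)) (strict_exts T s a b g)"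
      unfolding R strict_exts_def R' using m assms(3,4) by auto
    moreover have "max m (s - a) \<notin> strict_exts T s a b g"
      unfolding strict_exts_def R' using m by auto
    moreover have "finite (strict_exts T s a b g)"
      by (rule finite_subset[of _ "{..b}"]) (auto simp: strict_exts_def)
    ultimately show "card {q \<in> ?Q. ?R g q} = Suc (card (strict_exts T s a b g))"
      by simp
  qed
  also have "\<dots> = card (strict_paths T a b) + card (strict_paths (insert s T) a b)"
    using card_strict_paths_insert[OF assms(1,2), of a b]
    by (simp add: sum.distrib[of "\<lambda>_. Suc 0", simplified])
  finally show ?thesis .
qed

text \<open>Induction on the largest rank \<open>s\<close>, for all endpoints at once because the
  last point becomes the new endpoint. Each \<open>T \<subseteq> S\<close> then contributes the
  paths with valleys at \<open>T\<close> and those with valleys at \<open>insert s T\<close>, which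
  together exhaust the subsets of \<open>insert s S\<close>.\<close>

lemma card_weak_paths:
  assumes "finite S" "\<And>s. s \<in> S \<Longrightarrow> s \<le> a + b" "b \<le> a"
  shows "card (weak_paths S a b) = (\<Sum>T\<in>Pow S. card (strict_paths T a b))"
  using assms
proof (induction S arbitrary: a b rule: finite_linorder_max_induct)
  case empty
  then show ?case by (simp add: weak_paths_def strict_paths_def)
next
  case (insert s S)
  let ?Q = "{q. 2 * q \<le> s \<and> q \<le> b \<and> s - q \<le> a}"
  have "card (weak_paths (insert s S) a b) = (\<Sum>q\<in>?Q. card (weak_paths S (s - q) q))"
    using insert.hyps by (intro card_weak_paths_insert) auto
  also have "\<dots> = (\<Sum>q\<in>?Q. \<Sum>T\<in>Pow S. card (strict_paths T (s - q) q))"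
  proof (rule sum.cong[OF refl])
    fix q assume "q \<in> ?Q"
    then have "s = (s - q) + q" "q \<le> s - q" by auto
    then show "card (weak_paths S (s - q) q) = (\<Sum>T\<in>Pow S. card (strict_paths T (s - q) q))"
      using insert.hyps(2) by (intro insert.IH) (auto intro: less_imp_le)
  qed
  also have "\<dots> = (\<Sum>T\<in>Pow S. \<Sum>q\<in>?Q. card (strict_paths T (s - q) q))"
    by (rule sum.swap)
  also have "\<dots> = (\<Sum>T\<in>Pow S. card (strict_paths T a b) + card (strict_paths (insert s T) a b))"
    using insert.hyps insert.prems
    by (intro sum.cong[OF refl] sum_card_strict_paths) (auto intro: finite_subset)
  also have "\<dots> = (\<Sum>T\<in>Pow (insert s S). card (strict_paths T a b))"
  proof -
    have "s \<notin> S" using insert.hyps(2) by auto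
    then have "inj_on (insert s) (Pow S)" "Pow S \<inter> insert s ` Pow S = {}"
      by (auto simp: inj_on_def)
    then show ?thesis
      using insert.hyps(1) by (simp add: Pow_insert sum.union_disjoint sum.reindex sum.distrib)
  qed
  finally show ?case .
qed

section \<open>Order ideals of the product of chains and their flags\<close>

definition corner_ideal :: "nat \<Rightarrow> nat \<Rightarrow> (nat \<times> nat) set" where
  "corner_ideal a b = {1} \<times> {1..a} \<union> {2} \<times> {1..b}"

lemma card_corner_ideal: "card (corner_ideal a b) = a + b"
  unfolding corner_ideal_def by (subst card_Un_disjoint) (auto simp: card_cartesian_product)

text \<open>Turns chains of ideals into weakly increasing sequences of points; used in both
  directions, it shows that an ideal determines its point. The top elements \<open>(1, a)\<close>
  and \<open>(2, b)\<close> witness the inequalities.\<close>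

lemma corner_ideal_subset_iff: "corner_ideal a b \<subseteq> corner_ideal a' b' \<longleftrightarrow> a \<le> a' \<and> b \<le> b'"
proof
  assume sub: "corner_ideal a b \<subseteq> corner_ideal a' b'"
  show "a \<le> a' \<and> b \<le> b'"
  proof
    show "a \<le> a'"
      using subsetD[OF sub, of "(1, a)"] by (cases "a = 0") (auto simp: corner_ideal_def)
    show "b \<le> b'"
      using subsetD[OF sub, of "(2, b)"] by (cases "b = 0") (auto simp: corner_ideal_def)
  qed
qed (auto simp: corner_ideal_def)

lemma down_closed_interval:
  fixes A :: "nat set"
  assumes "A \<subseteq> {1..n}" "\<And>i j. i \<in> A \<Longrightarrow> 1 \<le> j \<Longrightarrow> j \<le> i \<Longrightarrow> j \<in> A"
  obtains a where "a \<le> n" "A = {1..a}"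
proof (cases "A = {}")
  case True
  then show ?thesis using that[of 0] by simp
next
  case False
  have "finite A" using assms(1) finite_subset by blast
  then have "Max A \<in> A" "\<And>i. i \<in> A \<Longrightarrow> i \<le> Max A" using False by auto
  then have "A = {1..Max A}" "Max A \<le> n"
    using assms by force+
  then show ?thesis using that by blast
qed

lemma order_ideals_two_times:
  "order_ideals (two_times n) = {corner_ideal a b | a b. b \<le> a \<and> a \<le> n}"
proof (intro equalityI subsetI)
  fix I assume "I \<in> order_ideals (two_times n)"
  then have sub: "I \<subseteq> {1..2} \<times> {1..n}"
    and down: "\<And>x y. x \<in> I \<Longrightarrow> y \<in> {1..2} \<times> {1..n} \<Longrightarrow> y \<le> x \<Longrightarrow> y \<in> I"
    by (auto simp: order_ideals_def two_times_def)
  have ex: "\<exists>a\<le>n. {j. (i, j) \<in> I} = {1..a}" for i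
  proof (rule down_closed_interval)
    show "{j. (i, j) \<in> I} \<subseteq> {1..n}"
      using sub by auto
    show "j' \<in> {j. (i, j) \<in> I}" if "j \<in> {j. (i, j) \<in> I}" "1 \<le> j'" "j' \<le> j" for j j'
      using down[of "(i, j)" "(i, j')"] sub that by (auto simp: less_eq_prod_def)
  qed blast
  obtain a where a: "a \<le> n" "{j. (1, j) \<in> I} = {1..a}" using ex[of 1] by auto
  obtain b where b: "b \<le> n" "{j. (2, j) \<in> I} = {1..b}" using ex[of 2] by auto
  have "(i, j) \<in> I \<longleftrightarrow> (i, j) \<in> corner_ideal a b" for i j
  proof -
    have "(i, j) \<in> I \<longrightarrow> i = 1 \<or> i = 2" using sub by auto
    then show ?thesis
      using a(2) b(2) by (auto simp: corner_ideal_def set_eq_iff)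
  qed
  then have "I = corner_ideal a b" by auto
  moreover have "b \<le> a"
  proof (cases "b = 0")
    case False
    then have "(2, b) \<in> I" using b(2) by auto
    \<comment> \<open>The relation \<open>(1, b) \<le> (2, b)\<close> between the two chains is what
      forces \<open>b \<le> a\<close>.\<close>
    then have "(1, b) \<in> I"
      using down[of "(2, b)" "(1, b)"] False b(1) by (auto simp: less_eq_prod_def)
    then show ?thesis using a(2) by auto
  qed simp
  ultimately show "I \<in> {corner_ideal a b | a b. b \<le> a \<and> a \<le> n}"
    using a(1) by blast
next
  fix I assume "I \<in> {corner_ideal a b | a b. b \<le> a \<and> a \<le> n}"
  then show "I \<in> order_ideals (two_times n)"
    by (auto simp: order_ideals_def two_times_def corner_ideal_def less_eq_prod_def)
qed

text \<open>Rank is cardinality, so a chain with rank set \<open>S\<close> has exactly one ideal of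
  each size \<open>s\<close> in \<open>S\<close>; \<open>f s\<close> records how many of its
  elements lie in the second chain.\<close>

lemma flag_f_two_times:
  assumes "finite S"
  shows "flag_f (order_ideals (two_times n)) S = card (weak_paths S n n)"
proof -
  let ?P = "order_ideals (two_times n)"
  let ?C = "\<lambda>f. (\<lambda>s. corner_ideal (s - f s) (f s)) ` S"
  have rank: "poset_rank ?P I = card I" if "I \<in> ?P" for I
    using that by (intro poset_rank_order_ideals) (auto simp: two_times_def)
  have "bij_betw ?C (weak_paths S n n) {c \<in> poset_chains ?P. poset_rank ?P ` c = S}"
  proof (rule bij_betwI')
    fix f g assume f: "f \<in> weak_paths S n n" and g: "g \<in> weak_paths S n n"
    show "?C f = ?C g \<longleftrightarrow> f = g"
    proof
      assume eq: "?C f = ?C g"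
      show "f = g"
      proof (rule extensionalityI)
        show "f \<in> extensional S" "g \<in> extensional S"
          using f g by (auto simp: weak_paths_def)
        fix s assume s: "s \<in> S"
        then obtain t where t: "t \<in> S" "corner_ideal (s - f s) (f s) = corner_ideal (t - g t) (g t)"
          using eq by blast
        then have "s - f s = t - g t" and fg: "f s = g t"
          using corner_ideal_subset_iff by (metis order_antisym subset_refl)+
        \<comment> \<open>These bounds make the truncated differences exact, so equal points have
          equal coordinate sums.\<close>
        moreover have "2 * f s \<le> s" "2 * g t \<le> t"
          using f g s t(1) by (auto simp: weak_paths_def)
        ultimately have "s = t" using fg by linarith
        then show "f s = g s" using fg by simp
      qed
    qed simp
  next
    fix f assume f: "f \<in> weak_paths S n n"
    then have in_P: "corner_ideal (s - f s) (f s) \<in> ?P"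
      and card_s: "card (corner_ideal (s - f s) (f s)) = s" if "s \<in> S" for s
      using that by (fastforce simp: weak_paths_def order_ideals_two_times card_corner_ideal)+
    have "corner_ideal (s - f s) (f s) \<subseteq> corner_ideal (t - f t) (f t)"
      if "s \<in> S" "t \<in> S" "s \<le> t" for s t
      using f that by (cases "s = t") (auto simp: weak_paths_def corner_ideal_subset_iff)
    then have "Complete_Partial_Order.chain (\<le>) (?C f)"
      by (intro chainI) (elim imageE, metis nat_le_linear)
    moreover have "poset_rank ?P ` ?C f = S"
      using in_P card_s by (simp add: rank image_image)
    ultimately show "?C f \<in> {c \<in> poset_chains ?P. poset_rank ?P ` c = S}"
      using in_P by (auto simp: poset_chains_def)
  next
    fix c assume "c \<in> {c \<in> poset_chains ?P. poset_rank ?P ` c = S}"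
    then have c: "c \<subseteq> ?P" "Complete_Partial_Order.chain (\<le>) c" and "poset_rank ?P ` c = S"
      by (auto simp: poset_chains_def)
    then have S: "card ` c = S"
      using image_cong[of c c "poset_rank ?P" card] rank by blast
    have "\<exists>b. 2 * b \<le> s \<and> s - b \<le> n \<and> corner_ideal (s - b) b \<in> c" if s: "s \<in> S" for s
    proof -
      obtain I where I: "I \<in> c" "card I = s" using S s by auto
      then obtain a b where "I = corner_ideal a b" "b \<le> a" "a \<le> n"
        using c(1) by (auto simp: order_ideals_two_times)
      then show ?thesis
        using I by (intro exI[of _ b]) (auto simp: card_corner_ideal)
    qed
    then obtain h where h: "\<And>s. s \<in> S \<Longrightarrow> 2 * h s \<le> s \<and> s - h s \<le> n \<and> corner_ideal (s - h s) (h s) \<in> c"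
      by metis
    define f where "f = restrict h S"
    have f: "2 * f s \<le> s" "s - f s \<le> n" "corner_ideal (s - f s) (f s) \<in> c" if "s \<in> S" for s
      using h that by (auto simp: f_def)
    have comparable: "I \<subseteq> J \<or> J \<subseteq> I" if "I \<in> c" "J \<in> c" for I J
      using c(2) that by (auto simp: chain_def)
    \<comment> \<open>The reverse inclusion of the two ideals would give \<open>t \<le> s\<close> on
      adding the coordinates.\<close>
    have mono: "f s \<le> f t \<and> s - f s \<le> t - f t" if "s \<in> S" "t \<in> S" "s < t" for s t
      using comparable[OF f(3) f(3), of s t] that f(1)[of s] f(1)[of t]
      by (auto simp: corner_ideal_subset_iff)
    have "f \<in> weak_paths S n n"
      unfolding weak_paths_def using f mono by (fastforce simp: f_def)
    moreover have "c = ?C f"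
    proof (intro equalityI subsetI)
      fix I assume I: "I \<in> c"
      then have s: "card I \<in> S" using S by auto
      obtain a b where ab: "I = corner_ideal a b" "b \<le> a"
        using c(1) I by (auto simp: order_ideals_two_times)
      let ?s = "a + b"
      have "?s \<in> S" using s ab by (simp add: card_corner_ideal)
      \<comment> \<open>\<open>I\<close> and the ideal chosen for rank \<open>?s\<close> are
        comparable and of equal size, hence equal.\<close>
      then have "a = ?s - f ?s \<and> b = f ?s"
        using comparable[OF I f(3), of ?s] f(1)[of ?s] by (auto simp: ab(1) corner_ideal_subset_iff)
      then show "I \<in> ?C f"
        using ab(1) \<open>?s \<in> S\<close> by (intro image_eqI[of _ _ ?s]) auto
    qed (use f(3) in auto)
    ultimately show "\<exists>f\<in>weak_paths S n n. c = ?C f" by blast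
  qed
  then show ?thesis
    unfolding flag_f_def by (simp add: bij_betw_same_card)
qed

section \<open>Two-column tableaux as strict paths\<close>

text \<open>The row with sum \<open>s\<close> is \<open>[f s, s - f s]\<close>. Positivity is
  \<open>0 < f s\<close>, the row condition is \<open>2 * f s \<le> s\<close>, the entry bound is
  \<open>s - f s < n\<close>, and strict columns are strict growth of both coordinates.\<close>

lemma card_tableaux_eq_card_strict_paths:
  assumes "finite S" "card S = k"
  shows "card {T \<in> semistandard_tableaux (replicate k 2).
      (\<forall>r\<in>set T. \<forall>x\<in>set r. x < n) \<and> set (row_sums T) = S} = card (strict_paths S n n)"
proof -
  let ?sl = "sorted_list_of_set S"
  let ?T = "\<lambda>f. map (\<lambda>s. [f s, s - f s]) ?sl"
  let ?A = "{T \<in> semistandard_tableaux (replicate k 2).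
      (\<forall>r\<in>set T. \<forall>x\<in>set r. x < n) \<and> set (row_sums T) = S}"
  have len: "length ?sl = k" using assms by simp
  have mem: "?sl ! i \<in> S" if "i < k" for i
    using assms(1) len that by (metis nth_mem set_sorted_list_of_set)
  have less: "?sl ! i < ?sl ! j" if "i < j" "j < k" for i j
    using strict_sorted_list_of_set[of S] that len sorted_wrt_nth_less by metis
  have "bij_betw ?T (strict_paths S n n) ?A"
  proof (rule bij_betwI')
    fix f g assume f: "f \<in> strict_paths S n n" and g: "g \<in> strict_paths S n n"
    show "?T f = ?T g \<longleftrightarrow> f = g"
    proof
      assume "?T f = ?T g"
      then have "f s = g s" if "s \<in> S" for s
        using that assms(1) by simp
      then show "f = g"
        using f g by (auto simp: strict_paths_def intro: extensionalityI)
    qed simp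
  next
    fix f assume f: "f \<in> strict_paths S n n"
    then have bd: "0 < f s \<and> 2 * f s \<le> s \<and> s - f s < n" if "s \<in> S" for s
      using that by (auto simp: strict_paths_def)
    have mono: "f s < f t \<and> s - f s < t - f t" if "s \<in> S" "t \<in> S" "s < t" for s t
      using f that by (auto simp: strict_paths_def)
    have "map length (?T f) = replicate k 2"
      using len by (auto simp: list_eq_iff_nth_eq)
    moreover have "\<forall>r\<in>set (?T f). \<forall>x\<in>set r. 0 < x" "\<forall>r\<in>set (?T f). sorted r"
      "\<forall>r\<in>set (?T f). \<forall>x\<in>set r. x < n"
      using bd assms(1) by fastforce+
    moreover have "?T f ! i ! j < ?T f ! i' ! j"
      if "i < i'" "i' < length (?T f)" "j < length (?T f ! i')" for i i' j
    proof -
      have "i' < k" using that(2) len by simp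
      then have "j = 0 \<or> j = 1" using that(3) len by auto
      moreover have "f (?sl ! i) < f (?sl ! i') \<and> ?sl ! i - f (?sl ! i) < ?sl ! i' - f (?sl ! i')"
        using mono mem less that(1) \<open>i' < k\<close> by simp
      ultimately show ?thesis using that(1) \<open>i' < k\<close> len by auto
    qed
    moreover have "set (row_sums (?T f)) = S"
    proof -
      have "f s + (s - f s) = s" if "s \<in> S" for s using bd[OF that] by simp
      then show ?thesis using assms(1) by (simp add: row_sums_def image_image)
    qed
    ultimately show "?T f \<in> ?A"
      unfolding semistandard_tableaux_def by blast
  next
    fix T assume "T \<in> ?A"
    then have lens: "map length T = replicate k 2"
      and pos: "\<And>r x. r \<in> set T \<Longrightarrow> x \<in> set r \<Longrightarrow> 0 < x"
      and sorted: "\<And>r. r \<in> set T \<Longrightarrow> sorted r"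
      and cols: "\<And>i i' j. i < i' \<Longrightarrow> i' < length T \<Longrightarrow> j < length (T ! i') \<Longrightarrow> T ! i ! j < T ! i' ! j"
      and bound: "\<And>r x. r \<in> set T \<Longrightarrow> x \<in> set r \<Longrightarrow> x < n"
      and sums: "sum_list ` set T = S"
      by (auto simp: semistandard_tableaux_def row_sums_def)
    have "length r = 2" if "r \<in> set T" for r
    proof -
      have "length r \<in> set (map length T)" using that by simp
      then show ?thesis unfolding lens by simp
    qed
    then have row: "r = [r ! 0, r ! 1]" if "r \<in> set T" for r
      using that by (auto simp: list_eq_iff_nth_eq less_2_cases_iff)
    have sum: "sum_list r = r ! 0 + r ! 1" if "r \<in> set T" for r
      using row[OF that] by (metis add.right_neutral sum_list.Cons sum_list.Nil)
    have entries: "0 < r ! 0 \<and> r ! 0 \<le> r ! 1 \<and> r ! 1 < n" if "r \<in> set T" for r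
    proof -
      have "length r = 2" using row[OF that] by (metis length_Cons list.size(3) numeral_2_eq_2)
      then show ?thesis
        using pos[OF that] bound[OF that] sorted[OF that] by (simp add: sorted_iff_nth_mono)
    qed
    have rows_less: "T ! i ! 0 < T ! j ! 0 \<and> T ! i ! 1 < T ! j ! 1" if "i < j" "j < length T" for i j
    proof -
      have "length (T ! j) = 2"
        using row[of "T ! j"] that(2) by (metis length_Cons list.size(3) nth_mem numeral_2_eq_2)
      then show ?thesis using cols that by simp
    qed
    have sum_less: "sum_list (T ! i) < sum_list (T ! j)" if "i < j" "j < length T" for i j
      using rows_less[OF that] that by (simp add: sum)
    then have ssum: "sorted_wrt (<) (map sum_list T)"
      by (simp add: sorted_wrt_iff_nth_less)
    \<comment> \<open>Row sums grow strictly down the columns, so \<open>S\<close> fixes the order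
      of the rows and each sum belongs to a single row.\<close>
    then have sl: "?sl = map sum_list T"
      using sums assms(1) by (metis list.set_map sorted_list_of_set.idem_if_sorted_distinct strict_sorted_iff)
    have inj: "inj_on sum_list (set T)"
      using ssum by (simp add: strict_sorted_iff distinct_map)
    define f where "f = restrict (\<lambda>s. the_inv_into (set T) sum_list s ! 0) S"
    have f: "f (sum_list r) = r ! 0" if "r \<in> set T" for r
      using that sums inj by (auto simp: f_def the_inv_into_f_f)
    have "f \<in> strict_paths S n n"
    proof -
      have "0 < f s \<and> 2 * f s \<le> s \<and> f s \<le> n \<and> s - f s < n" if s: "s \<in> S" for s
      proof -
        obtain r where r: "r \<in> set T" "s = sum_list r" using s sums by auto
        then show ?thesis using entries[OF r(1)] f[OF r(1)] sum[OF r(1)] by simp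
      qed
      moreover have "f s < f t \<and> s - f s < t - f t" if st: "s \<in> S" "t \<in> S" "s < t" for s t
      proof -
        obtain i j where ij: "i < length T" "s = sum_list (T ! i)" "j < length T" "t = sum_list (T ! j)"
          using st(1,2) unfolding sums[symmetric] by (auto simp: in_set_conv_nth)
        then have "i < j"
          using sum_less[of j i] st(3) by (cases i j rule: linorder_cases) auto
        then show ?thesis
          using rows_less[of i j] ij f[OF nth_mem] sum[OF nth_mem] by simp
      qed
      ultimately show ?thesis by (auto simp: strict_paths_def f_def)
    qed
    moreover have "T = ?T f"
    proof -
      have "[f (sum_list r), sum_list r - f (sum_list r)] = r" if "r \<in> set T" for r
        using row[OF that] f[OF that] sum[OF that] by simp
      then show ?thesis unfolding sl by (simp add: map_idI)
    qed
    ultimately show "\<exists>f\<in>strict_paths S n n. T = ?T f" by blast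
  qed
  then show ?thesis by (simp add: bij_betw_same_card)
qed

section \<open>Inversion of the flag f-vector\<close>

theorem theorem2p4:
  fixes n k :: nat and S :: "nat set"
  assumes "n > 0" and "S \<subseteq> {1..2 * n - 1}" and "card S = k"
  shows "flag_h (order_ideals (two_times n)) S =
    int (card {T \<in> semistandard_tableaux (replicate k 2).
      (\<forall>r\<in>set T. \<forall>x\<in>set r. x < n) \<and> set (row_sums T) = S})"
proof -
  have fin: "finite S" using assms(2) finite_subset by blast
  have "int (flag_f (order_ideals (two_times n)) T) =
      (\<Sum>U\<in>Pow T. int (card (strict_paths U n n)))" if "T \<subseteq> S" for T
  proof -
    have "finite T" using that fin finite_subset by blast
    \<comment> \<open>The full poset is the endpoint \<open>(n, n)\<close>, of rank
      \<open>n + n\<close>.\<close>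
    moreover have "s \<le> n + n" if "s \<in> T" for s
      using assms(2) \<open>T \<subseteq> S\<close> that by fastforce
    ultimately show ?thesis
      by (simp add: flag_f_two_times card_weak_paths)
  qed
  then have "flag_h (order_ideals (two_times n)) S =
      (\<Sum>T\<in>Pow S. (- 1) ^ card (S - T) * (\<Sum>U\<in>Pow T. int (card (strict_paths U n n))))"
    unfolding flag_h_def by (intro sum.cong) auto
  also have "\<dots> = int (card (strict_paths S n n))"
    by (rule alternating_sum_Pow[OF fin])
  finally show ?thesis
    using card_tableaux_eq_card_strict_paths[OF fin assms(3)] by simp
qed

end
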